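(* Let $(X,\mathcal{A},\lambda)$ be a $\sigma$-finite measure space, $T:X\to X$ a null-preserving map, and suppose there are sets $Z_1,\ldots,Z_m\in\mathcal{A}$ such that $Z_j\cap Z_l\overset{.}{=}\varnothing$ for $j\ne l$, and $\hat{T}Z_j\overset{.}{=}Y$ for all $j\in\{1,\ldots,m\}$ and some common $Y\in\mathcal{A}$ with $\lambda(Y)>0$. Then no $\lambda$-partition $\eta$ of $X$ with less than $m$ elements can be a generator for $(X,\mathcal{A},\lambda,T)$.
   Context: For $A,B\in\mathcal{A}$ write $A\overset{.}{\subseteq}B$ if $\lambda(A\setminus B)=0$ and $A\overset{.}{=}B$ if $\lambda(A\triangle B)=0$. A measurable map $T:X\to X$ is null-preserving if $\lambda(A)=0$ implies $\lambda(T^{-1}A)=0$ for $A\in\mathcal{A}$. An essential image of $A\in\mathcal{A}$ under $T$ is a set $A'\in\mathcal{A}$ such that $T^{-1}A'\overset{.}{\supseteq}A$ and such that every $B'\in\mathcal{A}$ with $T^{-1}B'\overset{.}{\supseteq}A$ satisfies $B'\overset{.}{\supseteq}A'$. In the present ($\sigma$-finite, null-preserving) setting every $A\in\mathcal{A}$ has essential images and they form exactly one equivalence class under $\overset{.}{=}$; $\hat{T}A$ denotes an arbitrary fixed essential image of $A$. A $\lambda$-partition of $X$ is a finite or countably infinite family $\eta\subseteq\mathcal{A}$ with $H\cap H'\overset{.}{=}\varnothing$ for distinct $H,H'\in\eta$ and $X\overset{.}{\subseteq}\bigcup_{H\in\eta}H$. It is a (one-sided) generator for the system if $\sigma(T^{-n}\eta:n\ge0)\overset{.}{=}\mathcal{A}$,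 meaning that for each $A\in\mathcal{A}$ there is $B\in\sigma(T^{-n}\eta:n\ge0)$ with $A\overset{.}{=}B$; here $T^{-n}\eta=\{T^{-n}H:H\in\eta\}$ and $\sigma(T^{-n}\eta:n\ge0)$ is the $\sigma$-algebra on $X$ generated by all these sets. *)

theory Defs
  imports "HOL-Analysis.Analysis"
begin

definition ae_subset :: "'a measure \<Rightarrow> 'a set \<Rightarrow> 'a set \<Rightarrow> bool" where
  "ae_subset M A B \<longleftrightarrow> A - B \<in> null_sets M"

definition ae_equal :: "'a measure \<Rightarrow> 'a set \<Rightarrow> 'a set \<Rightarrow> bool" where
  "ae_equal M A B \<longleftrightarrow> sym_diff A B \<in> null_sets M"

definition null_preserving :: "'a measure \<Rightarrow> ('a \<Rightarrow> 'a) \<Rightarrow> bool" where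
  "null_preserving M T \<longleftrightarrow>
     T \<in> measurable M M \<and> (\<forall>A\<in>null_sets M. T -` A \<inter> space M \<in> null_sets M)"

definition is_essential_image ::
    "'a measure \<Rightarrow> ('a \<Rightarrow> 'a) \<Rightarrow> 'a set \<Rightarrow> 'a set \<Rightarrow> bool" where
  "is_essential_image M T A A' \<longleftrightarrow>
     A' \<in> sets M \<and>
     ae_subset M A (T -` A' \<inter> space M) \<and>
     (\<forall>B'\<in>sets M. ae_subset M A (T -` B' \<inter> space M) \<longrightarrow> ae_subset M A' B')"

text \<open>
  A fixed choice of essential image; meaningful for null-preserving maps of \<open>\<sigma>\<close>-finite
  spaces, by the existence and uniqueness lemmas at the end of this theory.
\<close>

definition essential_image :: "'a measure \<Rightarrow> ('a \<Rightarrow> 'a) \<Rightarrow> 'a set \<Rightarrow> 'a set" where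
  "essential_image M T A = (SOME A'. is_essential_image M T A A')"

definition measure_partition :: "'a measure \<Rightarrow> 'a set set \<Rightarrow> bool" where
  "measure_partition M \<eta> \<longleftrightarrow>
     countable \<eta> \<and> \<eta> \<subseteq> sets M \<and>
     (\<forall>H\<in>\<eta>. \<forall>H'\<in>\<eta>. H \<noteq> H' \<longrightarrow> ae_equal M (H \<inter> H') {}) \<and>
     ae_subset M (space M) (\<Union>\<eta>)"

definition one_sided_generator :: "'a measure \<Rightarrow> ('a \<Rightarrow> 'a) \<Rightarrow> 'a set set \<Rightarrow> bool" where
  "one_sided_generator M T \<eta> \<longleftrightarrow>
     measure_partition M \<eta> \<and>
     (\<forall>A\<in>sets M. \<exists>B\<in>sigma_sets (space M) {(T ^^ n) -` H \<inter> space M | n H. H \<in> \<eta>}.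
        ae_equal M A B)"

lemma essential_image_unique:
  assumes "is_essential_image M T A A1" and "is_essential_image M T A A2"
  shows "ae_equal M A1 A2"
  using assms unfolding is_essential_image_def ae_subset_def ae_equal_def
  by (auto intro: null_sets.Un)

lemma essential_image_exists:
  assumes "sigma_finite_measure M" and "T \<in> measurable M M" and A: "A \<in> sets M"
  shows "\<exists>A'. is_essential_image M T A A'"
proof -
  interpret sigma_finite_measure M by fact
  have T[measurable]: "T \<in> measurable M M" by fact
  obtain h where h[measurable]: "h \<in> borel_measurable M" and fin: "integral\<^sup>N M h \<noteq> \<infinity>"
    and pos: "\<And>x. x \<in> space M \<Longrightarrow> 0 < h x"
    using Ex_finite_integrable_function by blast
  define N where "N = density M h"
  have setsN[simp]: "sets N = sets M" by (simp add: N_def)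
  interpret N: finite_measure N
    using fin unfolding N_def
    by (intro finite_measureI) (simp cong: nn_integral_cong add: emeasure_density)
  have null: "B \<in> null_sets M" if "B \<in> sets M" "measure N B = 0" for B
  proof -
    have "B \<in> null_sets N"
      using that by (auto simp: null_sets_def N.emeasure_eq_measure)
    then have "AE x in M. x \<in> B \<longrightarrow> h x = 0"
      unfolding N_def by (simp add: null_sets_density_iff)
    then have "AE x in M. x \<notin> B"
      by (rule AE_mp) (use pos in \<open>auto intro!: AE_I2 simp: less_le\<close>)
    then show ?thesis using that by (simp add: AE_iff_null_sets)
  qed
  define S where "S = {B \<in> sets M. A - (T -` B \<inter> space M) \<in> null_sets M}"
  define c where "c = Inf (measure N ` S)"
  have "space M \<in> S"
  proof -
    have "A - (T -` space M \<inter> space M) = {}"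
      using sets.sets_into_space[OF A] measurable_space[OF T] by auto
    then have "A - (T -` space M \<inter> space M) \<in> null_sets M"
      by (rule ssubst) simp
    then show ?thesis by (auto simp: S_def)
  qed
  then have ne: "measure N ` S \<noteq> {}" by auto
  have bdd: "bdd_below (measure N ` S)" by (rule bdd_belowI[of _ 0]) auto
  have lower: "c \<le> measure N B" if "B \<in> S" for B
    unfolding c_def using that bdd by (auto intro: cInf_lower)
  have "\<exists>B\<in>S. measure N B < c + 1 / Suc n" for n
    using cInf_lessD[OF ne, of "c + 1 / Suc n"] by (auto simp: c_def)
  then obtain B where B: "\<And>n. B n \<in> S" "\<And>n. measure N (B n) < c + 1 / Suc n" by metis
  define A' where "A' = (\<Inter>n. B n)"
  have Bm: "B n \<in> sets M" for n using B(1)[of n] by (simp add: S_def)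
  have A'm: "A' \<in> sets M" unfolding A'_def using Bm by auto
  have "A - (T -` A' \<inter> space M) = (\<Union>n. A - (T -` B n \<inter> space M))"
    by (auto simp: A'_def)
  also have "\<dots> \<in> null_sets M" by (rule null_sets_UN) (use B(1) in \<open>simp add: S_def\<close>)
  finally have A'S: "A - (T -` A' \<inter> space M) \<in> null_sets M" .
  have "measure N A' \<le> c + 1 / Suc n" for n
  proof -
    have "measure N A' \<le> measure N (B n)"
      by (rule N.finite_measure_mono) (auto simp: A'_def Bm)
    with B(2)[of n] show ?thesis by linarith
  qed
  moreover have "(\<lambda>n. c + 1 / Suc n) \<longlonglongrightarrow> c + 0"
    by (intro tendsto_intros LIMSEQ_Suc lim_1_over_n)
  ultimately have le: "measure N A' \<le> c" by (intro LIMSEQ_le_const) auto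
  have "A' - B' \<in> null_sets M"
    if B': "B' \<in> sets M" "A - (T -` B' \<inter> space M) \<in> null_sets M" for B'
  proof -
    have "A - (T -` (A' \<inter> B') \<inter> space M) =
        (A - (T -` A' \<inter> space M)) \<union> (A - (T -` B' \<inter> space M))" by auto
    then have "A' \<inter> B' \<in> S" using A'S B' A'm by (auto simp: S_def)
    then have "c \<le> measure N (A' \<inter> B')" by (rule lower)
    moreover have "measure N (A' - B') = measure N A' - measure N (A' \<inter> B')"
      using A'm B' by (intro N.finite_measure_Diff') auto
    ultimately have "measure N (A' - B') = 0"
      using le measure_nonneg[of N "A' - B'"] by linarith
    then show ?thesis using A'm B' by (intro null) auto
  qed
  then have "is_essential_image M T A A'"
    using A'm A'S by (auto simp: is_essential_image_def ae_subset_def)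
  then show ?thesis ..
qed

lemma essential_image:
  assumes "sigma_finite_measure M" and "null_preserving M T" and "A \<in> sets M"
  shows "is_essential_image M T A (essential_image M T A)"
  using essential_image_exists[of M T A] assms
  unfolding essential_image_def null_preserving_def by (auto intro: someI_ex)

end

theory Submission
  imports Defs
begin

text \<open>
  Modulo null sets, every set in \<open>\<sigma>(T\<^sup>-\<^sup>n \<eta> : n \<ge> 0)\<close> agrees on each \<open>H \<in> \<eta>\<close> with some \<open>T\<^sup>-\<^sup>1 C\<close>.
  If \<open>\<eta>\<close> generates, then \<open>Z\<^sub>j \<inter> H = H \<inter> T\<^sup>-\<^sup>1 C\<^sub>j\<^sub>H\<close>; put \<open>D\<^sub>j\<^sub>H = C\<^sub>j\<^sub>H \<inter> E\<^sub>H\<close> with \<open>E\<^sub>H\<close> the essential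
  image of \<open>H\<close>. For each \<open>j\<close> the sets \<open>D\<^sub>j\<^sub>H\<close>, \<open>H \<in> \<eta>\<close>, cover \<open>Y\<close>, while for fixed \<open>H\<close> the sets \<open>D\<^sub>j\<^sub>H\<close>
  are disjoint in \<open>j\<close>. With fewer \<open>H\<close> than \<open>j\<close>, the pigeonhole principle leaves almost no point
  for \<open>Y\<close>.
\<close>

lemma ae_subset_AE:
  assumes "ae_subset M A B"
  shows "AE x in M. x \<in> A \<longrightarrow> x \<in> B"
  using AE_not_in[of "A - B" M] assms unfolding ae_subset_def by auto

lemma ae_equal_AE:
  assumes "ae_equal M A B"
  shows "AE x in M. x \<in> A \<longleftrightarrow> x \<in> B"
  using AE_not_in[of "sym_diff A B" M] assms unfolding ae_equal_def by auto

lemma is_essential_image_AE_mem: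
  assumes "is_essential_image M T A A'"
  shows "AE x in M. x \<in> A \<longrightarrow> T x \<in> A'"
  using ae_subset_AE[of M A "T -` A' \<inter> space M"] assms
  unfolding is_essential_image_def by auto

text \<open>Minimality of the essential image in pointwise form: it turns a statement about
  \<open>T x\<close> for almost all \<open>x\<close> in \<open>A\<close> into one about almost all
  points of \<open>A'\<close>.\<close>

lemma is_essential_image_AE_least:
  assumes im: "is_essential_image M T A A'"
    and T: "T \<in> measurable M M" and A: "A \<in> sets M" and B: "B \<in> sets M"
    and sub: "AE x in M. x \<in> A \<longrightarrow> T x \<in> B"
  shows "AE x in M. x \<in> A' \<longrightarrow> x \<in> B"
proof -
  have "A - (T -` B \<inter> space M) \<in> sets M"
    using A measurable_sets[OF T B] by auto
  moreover have "AE x in M. x \<notin> A - (T -` B \<inter> space M)"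
    using sub AE_space by eventually_elim auto
  ultimately have "ae_subset M A (T -` B \<inter> space M)"
    unfolding ae_subset_def by (simp add: AE_iff_null_sets)
  then show ?thesis
    using im B ae_subset_AE unfolding is_essential_image_def by blast
qed

text \<open>The sets that agree almost everywhere on \<open>H\<close> with a
  \<open>T\<close>-preimage form a \<sigma>-algebra, so only the generators matter. For
  \<open>n > 0\<close> they are \<open>T\<close>-preimages already; for \<open>n = 0\<close> almost
  disjointness makes them all of \<open>H\<close> or null on \<open>H\<close>.\<close>

lemma sigma_sets_vimage_on_partition_element:
  assumes T: "T \<in> measurable M M" and \<eta>: "measure_partition M \<eta>" and H: "H \<in> \<eta>"
    and B: "B \<in> sigma_sets (space M) {(T ^^ n) -` H \<inter> space M | n H. H \<in> \<eta>}"
  shows "\<exists>C\<in>sets M. AE x in M. x \<in> H \<longrightarrow> (x \<in> B \<longleftrightarrow> T x \<in> C)"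
  using B
proof induction
  case (Basic G)
  then obtain n K where G: "G = (T ^^ n) -` K \<inter> space M" and K: "K \<in> \<eta>" by blast
  have Km: "K \<in> sets M" using K \<eta> by (auto simp: measure_partition_def)
  show ?case
  proof (cases n)
    case 0
    show ?thesis
    proof (cases "K = H")
      case True
      have "AE x in M. x \<in> H \<longrightarrow> (x \<in> G \<longleftrightarrow> T x \<in> space M)"
        using AE_space by eventually_elim (use measurable_space[OF T] in \<open>auto simp: G 0 True\<close>)
      then show ?thesis by blast
    next
      case False
      then have "ae_equal M (K \<inter> H) {}"
        using \<eta> H K by (auto simp: measure_partition_def)
      then have "AE x in M. x \<in> H \<longrightarrow> (x \<in> G \<longleftrightarrow> T x \<in> {})"
        by (rule ae_equal_AE[THEN AE_mp]) (auto simp: G 0)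
      then show ?thesis by blast
    qed
  next
    case (Suc k)
    \<comment> \<open>One factor \<open>T\<close> is split off \<open>T ^^ Suc k\<close>; the
      preimage under the remaining \<open>k\<close> iterates is the witness.\<close>
    have "(T ^^ k) -` K \<inter> space M \<in> sets M"
      using T Km by (intro measurable_sets[OF measurable_compose_n]) auto
    moreover have "AE x in M. x \<in> H \<longrightarrow> (x \<in> G \<longleftrightarrow> T x \<in> (T ^^ k) -` K \<inter> space M)"
      using AE_space
      by eventually_elim
        (use measurable_space[OF T] in \<open>auto simp: G Suc funpow_swap1\<close>)
    ultimately show ?thesis by blast
  qed
next
  case Empty
  show ?case by (rule bexI[of _ "{}"]) auto
next
  case (Compl G)
  then obtain C where C: "C \<in> sets M" and G: "AE x in M. x \<in> H \<longrightarrow> (x \<in> G \<longleftrightarrow> T x \<in> C)"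
    by blast
  have "AE x in M. x \<in> H \<longrightarrow> (x \<in> space M - G \<longleftrightarrow> T x \<in> space M - C)"
    using G AE_space by eventually_elim (use measurable_space[OF T] in auto)
  then show ?case using C by blast
next
  case (Union G)
  then obtain C where C: "\<And>i. C i \<in> sets M"
    and G: "\<And>i. AE x in M. x \<in> H \<longrightarrow> (x \<in> G i \<longleftrightarrow> T x \<in> C i)"
    by metis
  have "AE x in M. \<forall>i::nat. x \<in> H \<longrightarrow> (x \<in> G i \<longleftrightarrow> T x \<in> C i)"
    using G by (subst AE_all_countable) blast
  then have "AE x in M. x \<in> H \<longrightarrow> (x \<in> (\<Union>i. G i) \<longleftrightarrow> T x \<in> (\<Union>i. C i))"
    by eventually_elim auto
  then show ?case using C by (intro bexI[of _ "\<Union>i. C i"]) auto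
qed

theorem theorem6p1:
  fixes M :: "'a measure" and T :: "'a \<Rightarrow> 'a"
    and m :: nat and Z :: "nat \<Rightarrow> 'a set" and Y :: "'a set"
  assumes "sigma_finite_measure M"
    and "null_preserving M T"
    and "\<And>j. j \<in> {1..m} \<Longrightarrow> Z j \<in> sets M"
    and "\<And>j l. j \<in> {1..m} \<Longrightarrow> l \<in> {1..m} \<Longrightarrow> j \<noteq> l \<Longrightarrow> ae_equal M (Z j \<inter> Z l) {}"
    and "Y \<in> sets M"
    and "emeasure M Y > 0"
    and "\<And>j. j \<in> {1..m} \<Longrightarrow> ae_equal M (essential_image M T (Z j)) Y"
  shows "\<not> (\<exists>\<eta>. measure_partition M \<eta> \<and> finite \<eta> \<and> card \<eta> < m \<and>
               one_sided_generator M T \<eta>)"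
proof
  assume "\<exists>\<eta>. measure_partition M \<eta> \<and> finite \<eta> \<and> card \<eta> < m \<and> one_sided_generator M T \<eta>"
  then obtain \<eta> where \<eta>: "measure_partition M \<eta>" and fin: "finite \<eta>" and card: "card \<eta> < m"
    and gen: "one_sided_generator M T \<eta>" by blast
  have T: "T \<in> measurable M M" using assms(2) by (simp add: null_preserving_def)
  note Z = assms(3)
  have Hm: "H \<in> sets M" if "H \<in> \<eta>" for H using that \<eta> by (auto simp: measure_partition_def)
  note image = essential_image[OF assms(1,2)]
  define E where "E = essential_image M T"
  have Em: "E H \<in> sets M" if "H \<in> \<eta>" for H
    using image[OF Hm[OF that]] by (simp add: E_def is_essential_image_def)

  have "\<exists>C. C \<in> sets M \<and> (AE x in M. x \<in> H \<longrightarrow> (x \<in> Z j \<longleftrightarrow> T x \<in> C))"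
    if j: "j \<in> {1..m}" and H: "H \<in> \<eta>" for j H
  proof -
    obtain B where B: "B \<in> sigma_sets (space M) {(T ^^ n) -` H \<inter> space M | n H. H \<in> \<eta>}"
      and ZB: "ae_equal M (Z j) B"
      using gen Z[OF j] unfolding one_sided_generator_def by blast
    obtain C where C: "C \<in> sets M" and BC: "AE x in M. x \<in> H \<longrightarrow> (x \<in> B \<longleftrightarrow> T x \<in> C)"
      using sigma_sets_vimage_on_partition_element[OF T \<eta> H B] by blast
    have "AE x in M. x \<in> H \<longrightarrow> (x \<in> Z j \<longleftrightarrow> T x \<in> C)"
      using ae_equal_AE[OF ZB] BC by eventually_elim auto
    with C show ?thesis by blast
  qed
  then obtain C where Cm: "\<And>j H. j \<in> {1..m} \<Longrightarrow> H \<in> \<eta> \<Longrightarrow> C j H \<in> sets M"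
    and ZC: "\<And>j H. j \<in> {1..m} \<Longrightarrow> H \<in> \<eta> \<Longrightarrow> AE x in M. x \<in> H \<longrightarrow> (x \<in> Z j \<longleftrightarrow> T x \<in> C j H)"
    by metis

  have cover: "AE y in M. y \<in> Y \<longrightarrow> (\<exists>H\<in>\<eta>. y \<in> C j H \<inter> E H)" if j: "j \<in> {1..m}" for j
  proof -
    have "AE x in M. \<forall>H\<in>\<eta>. x \<in> H \<longrightarrow> (x \<in> Z j \<longleftrightarrow> T x \<in> C j H) \<and> T x \<in> E H"
      using ZC[OF j] is_essential_image_AE_mem[OF image[OF Hm]]
      by (intro AE_finite_allI[OF fin]) (auto simp: E_def imp_conjR)
    moreover have "AE x in M. x \<in> space M \<longrightarrow> x \<in> \<Union>\<eta>"
      using \<eta> by (intro ae_subset_AE) (simp add: measure_partition_def)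
    \<comment> \<open>Almost every \<open>x\<close> in \<open>Z j\<close> lies in some
      \<open>H\<close>, and there \<open>T x\<close> lies in both \<open>C j H\<close> and
      \<open>E H\<close>.\<close>
    ultimately have "AE x in M. x \<in> Z j \<longrightarrow> T x \<in> (\<Union>H\<in>\<eta>. C j H \<inter> E H)"
      using AE_space by eventually_elim blast
    then have "AE y in M. y \<in> essential_image M T (Z j) \<longrightarrow> y \<in> (\<Union>H\<in>\<eta>. C j H \<inter> E H)"
      using Cm[OF j] Em fin
      by (intro is_essential_image_AE_least[OF image[OF Z[OF j]] T Z[OF j]] sets.finite_UN) auto
    then show ?thesis
      using ae_equal_AE[OF assms(7)[OF j]] by eventually_elim blast
  qed

  have disj: "AE y in M. j \<noteq> l \<longrightarrow> \<not> (y \<in> C j H \<inter> E H \<and> y \<in> C l H \<inter> E H)"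
    if j: "j \<in> {1..m}" and l: "l \<in> {1..m}" and H: "H \<in> \<eta>" for j l H
  proof (cases "j = l")
    case False
    \<comment> \<open>If \<open>x\<close> is in \<open>H\<close> and \<open>T x\<close> is in
      \<open>C j H \<inter> C l H\<close>, then \<open>x\<close> is in the null set
      \<open>Z j \<inter> Z l\<close>, up to null sets. So minimality of \<open>E H\<close> makes
      \<open>C j H \<inter> C l H\<close> null inside \<open>E H\<close>; outside \<open>E H\<close>
      nothing controls the sets \<open>C j H\<close>, hence the intersection with
      \<open>E H\<close>.\<close>
    have "AE x in M. x \<in> H \<longrightarrow> T x \<in> space M - C j H \<inter> C l H"
      using ZC[OF j H] ZC[OF l H] ae_equal_AE[OF assms(4)[OF j l False]] AE_space
      by eventually_elim (use measurable_space[OF T] in auto)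
    then have "AE y in M. y \<in> essential_image M T H \<longrightarrow> y \<in> space M - C j H \<inter> C l H"
      using Cm[OF j H] Cm[OF l H]
      by (intro is_essential_image_AE_least[OF image[OF Hm[OF H]] T Hm[OF H]]) auto
    then show ?thesis by eventually_elim (auto simp: E_def)
  qed simp

  \<comment> \<open>All indices range over finite sets, so one exceptional null set serves for all
    of them and the counting can be done at a single point \<open>y\<close>.\<close>
  have "AE y in M. \<forall>j\<in>{1..m}. y \<in> Y \<longrightarrow> (\<exists>H\<in>\<eta>. y \<in> C j H \<inter> E H)"
    using cover by (intro AE_finite_allI) auto
  moreover have "AE y in M. \<forall>j\<in>{1..m}. \<forall>l\<in>{1..m}. \<forall>H\<in>\<eta>.
      j \<noteq> l \<longrightarrow> \<not> (y \<in> C j H \<inter> E H \<and> y \<in> C l H \<inter> E H)"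
    using disj fin by (intro AE_finite_allI) auto
  ultimately have "AE y in M. y \<notin> Y"
  proof eventually_elim
    case (elim y)
    show ?case
    proof
      assume "y \<in> Y"
      with elim(1) obtain h where h: "\<And>j. j \<in> {1..m} \<Longrightarrow> h j \<in> \<eta> \<and> y \<in> C j (h j) \<inter> E (h j)"
        by metis
      \<comment> \<open>Two indices with the same value under \<open>h\<close> put \<open>y\<close>
        into two sets that are disjoint at \<open>y\<close>.\<close>
      have "\<not> inj_on h {1..m}"
      proof (rule pigeonhole)
        have "card (h ` {1..m}) \<le> card \<eta>" using h fin by (intro card_mono) auto
        then show "card (h ` {1..m}) < card {1..m}" using card by simp
      qed
      then obtain j l where "j \<in> {1..m}" "l \<in> {1..m}" "j \<noteq> l" "h j = h l"
        by (auto simp: inj_on_def)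
      with elim(2) h show False by metis
    qed
  qed
  then have "Y \<in> null_sets M" using assms(5) by (simp add: AE_iff_null_sets)
  then show False using assms(6) by auto
qed

end
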